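(* (i) Let $p$ be a positive integer. If $G$ is a bipartite graph with both sides of order $p+1$, containing $K_{p,p}$, and with $p^2\le e(G)\le (p+1)^2-2$, then for $n\ge|G|$ $$\mathrm{ex}(n,K_{p,p})\le \mathrm{st}(n,G)\le \mathrm{ex}(n,K_{p+1,p+1}-e)\le O(n^{2-1/p}).$$ (ii) For any integers $p\ge q\ge 2$, if $G=K_{p,q}-e$, then for $n\ge|G|$ $$\tfrac12\,\mathrm{ex}(n,K_{p,q})\le \mathrm{st}(n,G)\le O(n^{2-1/p}).$$
   Context: Graphs are finite and simple; $|G|$ and $e(G)$ are the numbers of vertices and edges of $G$. $K_{a,b}-e$ is the complete bipartite graph $K_{a,b}$ with one edge deleted. The $O(\cdot)$ is for fixed $p,q$ and $n\to\infty$. $\mathrm{ex}(n,G)$ is the maximum number of edges of a graph on $n$ vertices containing no (not necessarily induced) copy of $G$. For a non-complete graph $G$ on $k$ vertices and $n\ge k$, $\mathrm{st}(n,G)$ is the largest $m$ for which there is a graph $H$ with $n$ vertices and $m$ edges such that no subgraph $F\subseteq H$ on exactly $k$ vertices contains $G$ as a proper subgraph. *)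

theory Defs
  imports Complex_Main "HOL-Library.Landau_Symbols"
begin

datatype 'a graph = Graph (verts: "'a set") (edges: "'a set set")

definition simple_graph :: "'a graph \<Rightarrow> bool" where
  "simple_graph G \<longleftrightarrow> finite (verts G) \<and> (\<forall>e\<in>edges G. e \<subseteq> verts G \<and> card e = 2)"

abbreviation num_verts :: "'a graph \<Rightarrow> nat" where
  "num_verts G \<equiv> card (verts G)"

abbreviation num_edges :: "'a graph \<Rightarrow> nat" where
  "num_edges G \<equiv> card (edges G)"

definition subgraph :: "'a graph \<Rightarrow> 'a graph \<Rightarrow> bool" where
  "subgraph F H \<longleftrightarrow> simple_graph F \<and> verts F \<subseteq> verts H \<and> edges F \<subseteq> edges H"

definition isomorphic :: "'a graph \<Rightarrow> 'b graph \<Rightarrow> bool" where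
  "isomorphic G H \<longleftrightarrow>
    (\<exists>f. bij_betw f (verts G) (verts H) \<and> (\<lambda>e. f ` e) ` edges G = edges H)"

definition contains_copy :: "'a graph \<Rightarrow> 'b graph \<Rightarrow> bool" where
  "contains_copy H G \<longleftrightarrow> (\<exists>F. subgraph F H \<and> isomorphic G F)"

definition contains_proper_copy :: "'a graph \<Rightarrow> 'b graph \<Rightarrow> bool" where
  "contains_proper_copy H G \<longleftrightarrow> (\<exists>F. subgraph F H \<and> F \<noteq> H \<and> isomorphic G F)"

text \<open>Every finite graph is isomorphic to one whose vertices are natural numbers, so the two
  extremal numbers below may range over graphs of type \<^typ>\<open>nat graph\<close>. The edge counts of graphs
  with \<open>n\<close> vertices are bounded, and the edgeless graph is admissible as soon as \<open>G\<close> has an edge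
  (for \<open>st_number\<close>: always), so the maxima are then taken over finite nonempty sets.\<close>

definition ex_number :: "nat \<Rightarrow> 'a graph \<Rightarrow> nat" where
  "ex_number n G =
    Max {num_edges H | H :: nat graph.
           simple_graph H \<and> num_verts H = n \<and> \<not> contains_copy H G}"

definition st_number :: "nat \<Rightarrow> 'a graph \<Rightarrow> nat" where
  "st_number n G =
    Max {num_edges H | H :: nat graph.
           simple_graph H \<and> num_verts H = n \<and>
           \<not> (\<exists>F. subgraph F H \<and> num_verts F = num_verts G \<and> contains_proper_copy F G)}"

definition bipartite_with_sides :: "'a graph \<Rightarrow> nat \<Rightarrow> nat \<Rightarrow> bool" where
  "bipartite_with_sides G a b \<longleftrightarrow>
    (\<exists>A B. verts G = A \<union> B \<and> A \<inter> B = {} \<and> card A = a \<and> card B = b \<and>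
       (\<forall>e\<in>edges G. \<exists>x\<in>A. \<exists>y\<in>B. e = {x, y}))"

definition complete_bipartite :: "nat \<Rightarrow> nat \<Rightarrow> (nat + nat) graph" where
  "complete_bipartite a b =
    Graph ({..<a} <+> {..<b}) {{Inl i, Inr j} | i j. i < a \<and> j < b}"

definition delete_edge :: "'a graph \<Rightarrow> 'a set \<Rightarrow> 'a graph" where
  "delete_edge G e = Graph (verts G) (edges G - {e})"

text \<open>All edges of a complete bipartite graph are equivalent under automorphisms, so it does not
  matter which one is deleted; the one chosen exists whenever \<open>a\<close> and \<open>b\<close> are positive.\<close>

definition complete_bipartite_minus_edge :: "nat \<Rightarrow> nat \<Rightarrow> (nat + nat) graph" where
  "complete_bipartite_minus_edge a b = delete_edge (complete_bipartite a b) {Inl 0, Inr 0}"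

end

theory Submission imports Defs begin

text \<open>
  A subgraph \<open>F\<close> of \<open>H\<close> on exactly \<open>|G|\<close> vertices that properly contains a copy of \<open>G\<close> amounts
  to an embedding \<open>f\<close> of \<open>G\<close> in \<open>H\<close> together with an edge of \<open>H\<close> inside the image of \<open>f\<close> that
  is not the image of an edge of \<open>G\<close>. Most of the inequalities follow directly: a graph without
  \<open>K\<^sub>p\<^sub>,\<^sub>p\<close> has no copy of \<open>G\<close> at all; and if \<open>G\<close> embeds in \<open>K\<close> so that \<open>K\<close> has an extra edge
  inside the image, then a graph admissible for \<open>st_number n G\<close> contains no \<open>K\<close>
  (\<open>st_number_le_ex_number\<close>). Taking for \<open>K\<close> the complete bipartite graph with sides \<open>p+1, p+1\<close>
  minus an edge gives the upper bound in terms of \<open>ex_number\<close>, both for the graphs of part (i) and for \<open>K\<^sub>p\<^sub>,\<^sub>q\<close> minus an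
  edge with \<open>q \<le> p\<close>.

  For the factor \<open>1/2\<close> in part (ii), let \<open>H\<close> be an extremal \<open>K\<^sub>p\<^sub>,\<^sub>q\<close>-free graph and keep at least
  half of its edges in a cut. For \<open>p, q \<ge> 2\<close> the graph \<open>K\<^sub>p\<^sub>,\<^sub>q\<close> minus an edge is connected, so the two
  sides of a copy lie on opposite sides of the cut. The only possible extra edge inside the
  vertices of the copy is the deleted one, and it would complete a \<open>K\<^sub>p\<^sub>,\<^sub>q\<close>.

  The order of magnitude comes from a variant of the Kovari-Sos-Turan count. Suppose
  \<open>H\<close> has no copy of the complete bipartite graph with sides \<open>p+1, p+1\<close> minus an edge. Call a
  \<open>p\<close>-set \<open>S\<close> of vertices rich if it has at least \<open>p+2\<close> common neighbours. If \<open>T\<close> is a \<open>p\<close>-set of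
  common neighbours of a rich \<open>S\<close>, then \<open>S\<close> consists of all common neighbours of \<open>T\<close>
  (\<open>common_nbrs_eq_if_no_copy\<close>), since another one could be added to \<open>S\<close>, and a further common
  neighbour of \<open>S\<close> to \<open>T\<close>. Hence each \<open>T\<close> arises from at most one rich \<open>S\<close>, and as
  \<open>d \<le> (d choose p) + p\<close>, the \<open>p\<close>-sets of vertices have \<open>O(n\<^sup>p)\<close> common neighbours in total. That
  total equals \<open>\<Sum>\<^sub>v (d(v) choose p)\<close>, which is at least of order \<open>n (m/n)\<^sup>p\<close>, up to an additive
  \<open>O(n)\<close>, when \<open>H\<close> has \<open>m\<close> edges. So \<open>m\<^sup>p = O(n\<^sup>2\<^sup>p\<^sup>-\<^sup>1)\<close>.
\<close>

section \<open>Copies as injective maps\<close>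

text \<open>An embedding is an injective, edge-preserving map into the vertices of \<open>H\<close>; its image need
  not be an induced subgraph. Values outside \<open>verts G\<close> are irrelevant.\<close>

definition embedding :: "('a \<Rightarrow> 'b) \<Rightarrow> 'a graph \<Rightarrow> 'b graph \<Rightarrow> bool" where
  "embedding f G H \<longleftrightarrow>
    inj_on f (verts G) \<and> f ` verts G \<subseteq> verts H \<and> (\<forall>e\<in>edges G. f ` e \<in> edges H)"

lemma embedding_edge: "embedding f G H \<Longrightarrow> e \<in> edges G \<Longrightarrow> f ` e \<in> edges H"
  by (simp add: embedding_def)

lemma simple_graph_edge_subset: "simple_graph G \<Longrightarrow> e \<in> edges G \<Longrightarrow> e \<subseteq> verts G"
  by (simp add: simple_graph_def)

lemma simple_graph_finite_edges: "simple_graph G \<Longrightarrow> finite (edges G)"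
  by (rule finite_subset[of _ "Pow (verts G)"]) (auto simp: simple_graph_def)

lemma num_edges_le: "simple_graph G \<Longrightarrow> num_edges G \<le> 2 ^ num_verts G"
  using card_mono[of "Pow (verts G)" "edges G"] by (auto simp: simple_graph_def card_Pow)

lemma embedding_imp_subgraph:
  assumes G: "simple_graph G" and f: "embedding f G H"
  defines "F \<equiv> Graph (f ` verts G) ((`) f ` edges G)"
  shows "subgraph F H" "isomorphic G F"
proof -
  have "card (f ` e) = 2" if "e \<in> edges G" for e
    using that G f by (metis card_image embedding_def inj_on_subset simple_graph_def)
  then show "subgraph F H"
    using G f unfolding F_def subgraph_def simple_graph_def embedding_def by auto
  show "isomorphic G F"
    unfolding isomorphic_def F_def
    using f by (intro exI[of _ f]) (auto simp: embedding_def bij_betw_def)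
qed

lemma contains_copy_iff_embedding:
  assumes "simple_graph G"
  shows "contains_copy H G \<longleftrightarrow> (\<exists>f. embedding f G H)"
proof
  assume "contains_copy H G"
  then obtain F f where F: "subgraph F H" "bij_betw f (verts G) (verts F)"
      "(\<lambda>e. f ` e) ` edges G = edges F"
    unfolding contains_copy_def isomorphic_def by blast
  then have "embedding f G H"
    unfolding embedding_def subgraph_def bij_betw_def by auto
  then show "\<exists>f. embedding f G H" by blast
next
  assume "\<exists>f. embedding f G H"
  then show "contains_copy H G"
    unfolding contains_copy_def using embedding_imp_subgraph[OF assms] by blast
qed

lemma embedding_comp:
  "embedding f G H \<Longrightarrow> embedding g H K \<Longrightarrow> embedding (g \<circ> f) G K"
  unfolding embedding_def image_comp[symmetric]
  by (metis comp_inj_on image_mono inj_on_subset order_trans)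

text \<open>The next two lemmas characterise the configurations forbidden for \<open>st_number\<close>. As \<open>F\<close> has as
  many vertices as \<open>G\<close>, a proper subgraph of \<open>F\<close> isomorphic to \<open>G\<close> has the vertices of \<open>F\<close> and
  lacks one of its edges.\<close>

lemma contains_proper_copyE:
  assumes "\<exists>F. subgraph F H \<and> num_verts F = num_verts G \<and> contains_proper_copy F G"
  obtains f e where "embedding f G H" "e \<in> edges H" "e \<subseteq> f ` verts G" "e \<notin> (`) f ` edges G"
proof -
  from assms obtain F F' f where F: "subgraph F H" "num_verts F = num_verts G"
      "subgraph F' F" "F' \<noteq> F" "bij_betw f (verts G) (verts F')"
      "(\<lambda>e. f ` e) ` edges G = edges F'"
    unfolding contains_proper_copy_def isomorphic_def by blast
  have "finite (verts F)" "verts F' \<subseteq> verts F" "card (verts F') = card (verts F)"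
    using F by (auto simp: subgraph_def simple_graph_def bij_betw_same_card)
  then have vF: "verts F' = verts F"
    by (simp add: card_subset_eq)
  moreover have "edges F' \<subseteq> edges F" using F by (simp add: subgraph_def)
  ultimately obtain e where e: "e \<in> edges F" "e \<notin> edges F'"
    using \<open>F' \<noteq> F\<close> by (metis graph.expand subset_antisym subsetI)
  have f: "f ` verts G = verts F'" "inj_on f (verts G)"
    using F by (simp_all add: bij_betw_def)
  have sub: "verts F' \<subseteq> verts H" "edges F' \<subseteq> edges H" "edges F \<subseteq> edges H" "e \<subseteq> verts F"
    using F e by (auto simp: subgraph_def simple_graph_def)
  have "embedding f G H"
    unfolding embedding_def
  proof (intro conjI ballI)
    fix e' assume "e' \<in> edges G"
    then have "f ` e' \<in> edges F'" unfolding F(6)[symmetric] by (rule imageI)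
    then show "f ` e' \<in> edges H" using sub by blast
  qed (simp_all add: f sub)
  moreover have "e \<in> edges H" using e sub by blast
  moreover have "e \<subseteq> f ` verts G" using f sub vF by simp
  moreover have "e \<notin> (`) f ` edges G" using e F(6) by simp
  ultimately show ?thesis by (rule that)
qed

lemma contains_proper_copyI:
  assumes G: "simple_graph G" and H: "simple_graph H" and f: "embedding f G H"
    and e: "e \<in> edges H" "e \<subseteq> f ` verts G" "e \<notin> (`) f ` edges G"
  shows "\<exists>F. subgraph F H \<and> num_verts F = num_verts G \<and> contains_proper_copy F G"
proof -
  let ?F' = "Graph (f ` verts G) ((`) f ` edges G)"
  let ?F = "Graph (f ` verts G) (insert e ((`) f ` edges G))"
  have F': "subgraph ?F' H" "isomorphic G ?F'"
    using embedding_imp_subgraph[OF G f] by auto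
  have "subgraph ?F H"
    using F'(1) e H by (auto simp: subgraph_def simple_graph_def)
  moreover have "subgraph ?F' ?F"
    using F'(1) by (auto simp: subgraph_def)
  moreover have "?F' \<noteq> ?F" using e by auto
  moreover have "num_verts ?F = num_verts G"
    using f by (simp add: embedding_def card_image)
  ultimately show ?thesis
    using F'(2) unfolding contains_proper_copy_def by blast
qed

section \<open>The two extremal numbers\<close>

lemma finite_num_edges: "finite {num_edges H | H :: 'a graph. simple_graph H \<and> num_verts H = n \<and> P H}"
  by (rule finite_subset[of _ "{..2 ^ n}"]) (use num_edges_le in auto)

lemma ex_number_ge:
  fixes H :: "nat graph"
  assumes "simple_graph H" "\<not> contains_copy H G"
  shows "num_edges H \<le> ex_number (num_verts H) G"
  unfolding ex_number_def using assms by (intro Max_ge[OF finite_num_edges]) blast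

lemma ex_number_attained:
  assumes "edges G \<noteq> {}"
  obtains H :: "nat graph" where "simple_graph H" "num_verts H = n" "\<not> contains_copy H G"
    "num_edges H = ex_number n G"
proof -
  let ?X = "{num_edges H | H :: nat graph.
           simple_graph H \<and> num_verts H = n \<and> \<not> contains_copy H G}"
  let ?E = "Graph {..<n} {}"
  have "simple_graph ?E" "num_verts ?E = n" by (auto simp: simple_graph_def)
  moreover have "\<not> contains_copy ?E G"
    using assms by (auto simp: contains_copy_def subgraph_def isomorphic_def)
  ultimately have "?X \<noteq> {}" by blast
  then have "Max ?X \<in> ?X" by (intro Max_in[OF finite_num_edges])
  then show ?thesis using that unfolding ex_number_def by auto
qed

lemma st_number_ge:
  fixes H :: "nat graph"
  assumes "simple_graph H"
    "\<not> (\<exists>F. subgraph F H \<and> num_verts F = num_verts G \<and> contains_proper_copy F G)"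
  shows "num_edges H \<le> st_number (num_verts H) G"
  unfolding st_number_def using assms by (intro Max_ge[OF finite_num_edges]) blast

lemma st_number_attained:
  assumes "simple_graph G"
  obtains H :: "nat graph" where "simple_graph H" "num_verts H = n"
    "\<not> (\<exists>F. subgraph F H \<and> num_verts F = num_verts G \<and> contains_proper_copy F G)"
    "num_edges H = st_number n G"
proof -
  let ?P = "\<lambda>H :: nat graph.
     \<not> (\<exists>F. subgraph F H \<and> num_verts F = num_verts G \<and> contains_proper_copy F G)"
  let ?X = "{num_edges H | H. simple_graph H \<and> num_verts H = n \<and> ?P H}"
  let ?E = "Graph {..<n} {}"
  have "simple_graph ?E" "num_verts ?E = n" by (auto simp: simple_graph_def)
  moreover have "?P ?E"
    by (rule notI, erule contains_proper_copyE) simp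
  ultimately have "?X \<noteq> {}" by blast
  then have "Max ?X \<in> ?X" by (intro Max_in[OF finite_num_edges])
  then show ?thesis using that unfolding st_number_def by auto
qed

text \<open>If \<open>K\<close> contains \<open>G\<close> and an extra edge inside the same vertices, then a copy of \<open>K\<close> is
  forbidden in the graphs over which \<open>st_number n G\<close> is a maximum.\<close>

lemma st_number_le_ex_number:
  fixes G :: "'a graph" and K :: "'b graph"
  assumes G: "simple_graph G" and K: "simple_graph K"
    and f: "embedding f G K" and e: "e \<in> edges K" "e \<subseteq> f ` verts G" "e \<notin> (`) f ` edges G"
  shows "st_number n G \<le> ex_number n K"
proof -
  obtain H :: "nat graph" where H: "simple_graph H" "num_verts H = n"
    "\<not> (\<exists>F. subgraph F H \<and> num_verts F = num_verts G \<and> contains_proper_copy F G)"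
    "num_edges H = st_number n G"
    using st_number_attained[OF G] .
  have "\<not> contains_copy H K"
  proof
    assume "contains_copy H K"
    then obtain g where g: "embedding g K H"
      using contains_copy_iff_embedding[OF K] by blast
    have "g ` e \<notin> (`) (g \<circ> f) ` edges G"
    proof
      assume "g ` e \<in> (`) (g \<circ> f) ` edges G"
      then obtain e' where e': "e' \<in> edges G" "g ` e = g ` (f ` e')" by (auto simp: image_comp)
      have "e \<subseteq> verts K" "f ` e' \<subseteq> verts K"
        using e(1) e'(1) f K by (auto simp: embedding_def simple_graph_def)
      then have "e = f ` e'"
        using e'(2) g inj_on_image_eq_iff unfolding embedding_def by metis
      then show False using e e' by blast
    qed
    moreover have "g ` e \<in> edges H" "g ` e \<subseteq> (g \<circ> f) ` verts G"
      using g e by (simp_all add: embedding_def image_comp[symmetric] image_mono del: o_apply)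
    moreover have "embedding (g \<circ> f) G H" using embedding_comp f g by blast
    ultimately show False
      using H(3) contains_proper_copyI[OF G H(1), of "g \<circ> f" "g ` e"] by simp
  qed
  then show ?thesis using ex_number_ge[OF H(1)] H by metis
qed

lemma ex_number_le_st_number:
  fixes G :: "'a graph" and K :: "'b graph"
  assumes G: "simple_graph G" and K: "simple_graph K" "edges K \<noteq> {}" and "contains_copy G K"
  shows "ex_number n K \<le> st_number n G"
proof -
  obtain f where f: "embedding f K G"
    using assms contains_copy_iff_embedding by blast
  obtain H :: "nat graph" where H: "simple_graph H" "num_verts H = n" "\<not> contains_copy H K"
    "num_edges H = ex_number n K"
    using ex_number_attained[OF K(2)] .
  have "\<not> (\<exists>g. embedding g G H)"
    using H(3) embedding_comp[OF f] contains_copy_iff_embedding[OF K(1)] by blast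
  then have "\<not> (\<exists>F. subgraph F H \<and> num_verts F = num_verts G \<and> contains_proper_copy F G)"
    by (meson contains_proper_copyE)
  then show ?thesis using st_number_ge[OF H(1)] H by metis
qed

section \<open>Complete bipartite graphs with an edge deleted\<close>

lemma verts_complete_bipartite [simp]: "verts (complete_bipartite a b) = {..<a} <+> {..<b}"
  by (simp add: complete_bipartite_def)

lemma edges_complete_bipartite:
  "edges (complete_bipartite a b) = {{Inl i, Inr j} | i j. i < a \<and> j < b}"
  by (simp add: complete_bipartite_def)

lemma verts_complete_bipartite_minus_edge [simp]:
  "verts (complete_bipartite_minus_edge a b) = {..<a} <+> {..<b}"
  by (simp add: complete_bipartite_minus_edge_def delete_edge_def)

lemma edges_complete_bipartite_minus_edge:
  "edges (complete_bipartite_minus_edge a b)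
     = {{Inl i, Inr j} | i j. i < a \<and> j < b \<and> (i, j) \<noteq> (0, 0)}" (is "_ = ?R")
proof -
  have eq: "{Inl i, Inr j} = {Inl 0, Inr 0} \<longleftrightarrow> (i, j) = (0, 0)" for i j :: nat
    by (simp add: doubleton_eq_iff)
  have "edges (complete_bipartite_minus_edge a b) = {{Inl i, Inr j} | i j. i < a \<and> j < b} - {{Inl 0, Inr 0}}"
    by (simp add: complete_bipartite_minus_edge_def delete_edge_def edges_complete_bipartite)
  also have "\<dots> = ?R"
  proof (intro equalityI subsetI)
    fix e assume "e \<in> {{Inl i, Inr j} | i j. i < a \<and> j < b} - {{Inl 0, Inr 0}}"
    then obtain i j where "e = {Inl i, Inr j}" "i < a" "j < b" "e \<noteq> {Inl 0, Inr 0}" by blast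
    then show "e \<in> ?R" using eq by blast
  next
    fix e assume "e \<in> ?R"
    then obtain i j where "e = {Inl i, Inr j}" "i < a" "j < b" "(i, j) \<noteq> (0, 0)" by blast
    then show "e \<in> {{Inl i, Inr j} | i j. i < a \<and> j < b} - {{Inl 0, Inr 0}}" using eq by blast
  qed
  finally show ?thesis .
qed

lemma complete_bipartite_edgeI:
  "i < a \<Longrightarrow> j < b \<Longrightarrow> {Inl i, Inr j} \<in> edges (complete_bipartite a b)"
  unfolding edges_complete_bipartite by blast

lemma complete_bipartite_minus_edge_edgeI:
  "i < a \<Longrightarrow> j < b \<Longrightarrow> (i, j) \<noteq> (0, 0) \<Longrightarrow>
     {Inl i, Inr j} \<in> edges (complete_bipartite_minus_edge a b)"
  unfolding edges_complete_bipartite_minus_edge by blast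

lemma simple_complete_bipartite [simp]: "simple_graph (complete_bipartite a b)"
  by (auto simp: simple_graph_def edges_complete_bipartite)

lemma simple_complete_bipartite_minus_edge [simp]:
  "simple_graph (complete_bipartite_minus_edge a b)"
  using simple_complete_bipartite[of a b]
  by (simp add: simple_graph_def complete_bipartite_minus_edge_def delete_edge_def)

lemma bij_betw_with_value:
  assumes "finite A" "finite B" "card A = card B" "x \<in> A" "y \<in> B"
  obtains f where "bij_betw f A B" "f x = y"
proof -
  have "card (A - {x}) = card (B - {y})" using assms by simp
  then obtain f where f: "bij_betw f (A - {x}) (B - {y})"
    using assms finite_same_card_bij by blast
  have "bij_betw (f(x := y)) (A - {x}) (B - {y})"
    using f by (subst bij_betw_cong[of _ _ f]) auto
  then have "bij_betw (f(x := y)) ((A - {x}) \<union> {x}) ((B - {y}) \<union> {y})"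
    by (rule bij_betw_combine) auto
  moreover have "(A - {x}) \<union> {x} = A" "(B - {y}) \<union> {y} = B" using assms by auto
  ultimately show ?thesis using that[of "f(x := y)"] by simp
qed

text \<open>The missing edge may join any \<open>x \<in> A\<close> to any \<open>y \<in> B\<close>: the sides are enumerated so that
  \<open>x\<close> and \<open>y\<close> get the number \<open>0\<close>, as in the representative \<open>complete_bipartite_minus_edge\<close>.\<close>

lemma contains_copy_complete_bipartite_minus_edgeI:
  assumes "finite A" "finite B" "A \<union> B \<subseteq> verts H" "A \<inter> B = {}" "x \<in> A" "y \<in> B"
    and E: "\<And>u v. u \<in> A \<Longrightarrow> v \<in> B \<Longrightarrow> (u, v) \<noteq> (x, y) \<Longrightarrow> {u, v} \<in> edges H"
  shows "contains_copy H (complete_bipartite_minus_edge (card A) (card B))"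
proof -
  have "0 < card A" "0 < card B" using assms by (auto simp: card_gt_0_iff)
  then obtain f g where f: "bij_betw f {..<card A} A" "f 0 = x"
     and g: "bij_betw g {..<card B} B" "g 0 = y"
    using bij_betw_with_value[of "{..<card A}" A 0 x] bij_betw_with_value[of "{..<card B}" B 0 y] assms
    by (metis card_lessThan finite_lessThan lessThan_iff)
  have fA: "f i \<in> A" if "i < card A" for i using f that by (auto simp: bij_betw_def)
  have gB: "g i \<in> B" if "i < card B" for i using g that by (auto simp: bij_betw_def)
  have fx: "f i = x \<Longrightarrow> i = 0" if "i < card A" for i
    using f \<open>0 < card A\<close> that unfolding bij_betw_def inj_on_def by auto
  have gy: "g i = y \<Longrightarrow> i = 0" if "i < card B" for i
    using g \<open>0 < card B\<close> that unfolding bij_betw_def inj_on_def by auto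
  have "inj_on (case_sum f g) ({..<card A} <+> {..<card B})"
    using f g fA gB \<open>A \<inter> B = {}\<close> by (force simp: inj_on_def bij_betw_def)
  moreover have "case_sum f g ` ({..<card A} <+> {..<card B}) \<subseteq> verts H"
    using fA gB assms by auto
  moreover have "case_sum f g ` e \<in> edges H"
    if "e \<in> edges (complete_bipartite_minus_edge (card A) (card B))" for e
    using that unfolding edges_complete_bipartite_minus_edge by (auto intro!: E fA gB dest: fx gy)
  ultimately have "embedding (case_sum f g) (complete_bipartite_minus_edge (card A) (card B)) H"
    by (simp add: embedding_def)
  then show ?thesis
    using contains_copy_iff_embedding simple_complete_bipartite_minus_edge by blast
qed

lemma card_unordered_product:
  assumes "A \<inter> B = {}"
  shows "card {{x, y} | x y. x \<in> A \<and> y \<in> B} = card A * card B"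
proof -
  have "inj_on (\<lambda>(x, y). {x, y}) (A \<times> B)"
    using assms by (auto simp: inj_on_def doubleton_eq_iff)
  moreover have "{{x, y} | x y. x \<in> A \<and> y \<in> B} = (\<lambda>(x, y). {x, y}) ` (A \<times> B)" by auto
  ultimately show ?thesis by (simp add: card_image card_cartesian_product)
qed

lemma num_edges_complete_bipartite: "num_edges (complete_bipartite a b) = a * b"
proof -
  have "edges (complete_bipartite a b)
      = {{x, y} | x y. x \<in> Inl ` {..<a} \<and> y \<in> Inr ` {..<b}}"
    by (auto simp: edges_complete_bipartite)
  also have "card \<dots> = a * b"
    by (subst card_unordered_product) (auto simp: card_image)
  finally show ?thesis .
qed

text \<open>Two edges are missing from \<open>G\<close>: one is matched with the edge deleted from the complete
  bipartite graph, so that \<open>G\<close> embeds, and the other one then gives the extra edge.\<close>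

lemma st_number_le_ex_number_minus_edge:
  fixes G :: "'a graph"
  assumes G: "simple_graph G" and bip: "bipartite_with_sides G a b"
    and e: "num_edges G + 2 \<le> a * b"
  shows "st_number n G \<le> ex_number n (complete_bipartite_minus_edge a b)"
proof -
  let ?K = "complete_bipartite_minus_edge a b"
  obtain A B where AB: "verts G = A \<union> B" "A \<inter> B = {}" "card A = a" "card B = b"
    and edgeE: "\<And>e. e \<in> edges G \<Longrightarrow> \<exists>x\<in>A. \<exists>y\<in>B. e = {x, y}"
    using bip unfolding bipartite_with_sides_def by metis
  have fin: "finite A" "finite B" using G AB by (auto simp: simple_graph_def)
  have "\<not> {{x, y} | x y. x \<in> A \<and> y \<in> B} \<subseteq> edges G"
  proof
    assume "{{x, y} | x y. x \<in> A \<and> y \<in> B} \<subseteq> edges G"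
    from card_mono[OF simple_graph_finite_edges[OF G] this] have "a * b \<le> num_edges G"
      by (simp add: card_unordered_product[OF AB(2)] AB)
    then show False using e by simp
  qed
  then obtain x y where xy: "x \<in> A" "y \<in> B" "{x, y} \<notin> edges G" by blast
  have ab: "0 < a" "0 < b" using e by (auto intro: Nat.gr0I)
  obtain f where f: "bij_betw f A {..<a}" "f x = 0"
    using bij_betw_with_value[of A "{..<a}" x 0] fin AB ab xy by auto
  obtain g where g: "bij_betw g B {..<b}" "g y = 0"
    using bij_betw_with_value[of B "{..<b}" y 0] fin AB ab xy by auto
  define h where "h u = (if u \<in> A then Inl (f u) else Inr (g u))" for u
  have hB: "h v = Inr (g v)" if "v \<in> B" for v using that AB by (auto simp: h_def)
  have hA: "h u = Inl (f u)" if "u \<in> A" for u using that by (simp add: h_def)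
  have "inj_on h (A \<union> B)"
    using f g AB by (auto simp: inj_on_def bij_betw_def h_def)
  moreover have him: "h ` (A \<union> B) = {..<a} <+> {..<b}"
  proof -
    have "h ` A = Inl ` f ` A" "h ` B = Inr ` g ` B"
      using hA hB by (auto simp: image_image intro!: image_cong)
    then show ?thesis using f g by (simp add: image_Un bij_betw_def Plus_def)
  qed
  moreover have "h ` e \<in> edges ?K" if "e \<in> edges G" for e
  proof -
    obtain u v where uv: "u \<in> A" "v \<in> B" "e = {u, v}" using edgeE \<open>e \<in> edges G\<close> by blast
    have "(f u, g v) \<noteq> (0, 0)"
    proof
      assume "(f u, g v) = (0, 0)"
      then have "u = x" "v = y" using f g uv xy by (auto simp: bij_betw_def inj_on_def)
      then show False using xy uv that by simp
    qed
    moreover have "f u < a" "g v < b" using f g uv by (auto simp: bij_betw_def)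
    ultimately show ?thesis
      using uv hA hB by (simp add: complete_bipartite_minus_edge_edgeI)
  qed
  ultimately have emb: "embedding h G ?K" by (simp add: embedding_def AB)
  have "{Inl 0, Inr 0} \<in> edges (complete_bipartite a b)"
    using ab by (rule complete_bipartite_edgeI)
  then have "card (edges ?K) = a * b - 1"
    by (simp add: complete_bipartite_minus_edge_def delete_edge_def num_edges_complete_bipartite
        card_Diff_singleton)
  moreover have "card ((`) h ` edges G) \<le> num_edges G"
    using simple_graph_finite_edges[OF G] by (rule card_image_le)
  ultimately have "\<not> edges ?K \<subseteq> (`) h ` edges G"
    using card_mono[of "(`) h ` edges G" "edges ?K"] simple_graph_finite_edges[OF G] e by auto
  then obtain e where e: "e \<in> edges ?K" "e \<notin> (`) h ` edges G" by blast
  have "e \<subseteq> h ` verts G"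
    using simple_graph_edge_subset[OF simple_complete_bipartite_minus_edge e(1)] him AB by simp
  then show ?thesis
    using st_number_le_ex_number[OF G _ emb] e by simp
qed

lemma st_number_minus_edge_le_ex_number:
  assumes "1 \<le> q" "q \<le> p"
  shows "st_number n (complete_bipartite_minus_edge p q)
           \<le> ex_number n (complete_bipartite_minus_edge (p + 1) (p + 1))"
proof (rule st_number_le_ex_number)
  \<comment> \<open>Shifting the first side by one moves the image away from the deleted edge, whereas the
    edge deleted from the smaller graph is mapped to the edge \<open>?e\<close> that is present.\<close>
  let ?f = "map_sum Suc (id :: nat \<Rightarrow> nat)" and ?e = "{Inl 1, Inr 0} :: (nat + nat) set"
  show "embedding ?f (complete_bipartite_minus_edge p q)
      (complete_bipartite_minus_edge (p + 1) (p + 1))"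
    using assms unfolding embedding_def edges_complete_bipartite_minus_edge
    by (force simp: inj_on_def)
  show "?e \<in> edges (complete_bipartite_minus_edge (p + 1) (p + 1))"
    using assms by (intro complete_bipartite_minus_edge_edgeI) auto
  show "?e \<subseteq> ?f ` verts (complete_bipartite_minus_edge p q)"
    using assms by (force simp: image_iff)
  show "?e \<notin> (`) ?f ` edges (complete_bipartite_minus_edge p q)"
  proof
    assume "?e \<in> (`) ?f ` edges (complete_bipartite_minus_edge p q)"
    then obtain e where e: "e \<in> edges (complete_bipartite_minus_edge p q)" "?e = ?f ` e"
      by (rule imageE)
    from e(1) obtain i j where "e = {Inl i, Inr j}" "(i, j) \<noteq> (0, 0)"
      unfolding edges_complete_bipartite_minus_edge by auto
    then show False using e(2) by (simp add: doubleton_eq_iff)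
  qed
qed simp_all

section \<open>Bipartite subgraphs with half of the edges\<close>

text \<open>The cut determined by \<open>X\<close> consists of the edges meeting \<open>X\<close> in exactly one vertex. A new
  vertex \<open>v\<close> is put on the side from which at most half of its edges are lost.\<close>

lemma exists_large_cut:
  assumes "finite V" "\<And>e. e \<in> E \<Longrightarrow> e \<subseteq> V \<and> card e = 2"
  shows "\<exists>X\<subseteq>V. card E \<le> 2 * card {e \<in> E. card (e \<inter> X) = 1}"
  using assms
proof (induction V arbitrary: E rule: finite_induct)
  case empty
  then have "E = {}" by force
  then show ?case by simp
next
  case (insert v V)
  have finE: "finite E"
    using insert by (intro finite_subset[of E "Pow (insert v V)"]) auto
  define E' where "E' = {e \<in> E. v \<notin> e}"
  obtain X where X: "X \<subseteq> V" "card E' \<le> 2 * card {e \<in> E'. card (e \<inter> X) = 1}"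
    using insert.IH[of E'] insert.prems unfolding E'_def by fastforce
  let ?I = "{e \<in> E. v \<in> e \<and> card (e \<inter> X) = 1}" and ?O = "{e \<in> E. v \<in> e \<and> card (e \<inter> X) \<noteq> 1}"
  have vX: "v \<notin> X" using X insert.hyps by auto
  have "E = E' \<union> (?I \<union> ?O)" by (auto simp: E'_def)
  moreover have "E' \<inter> (?I \<union> ?O) = {}" "?I \<inter> ?O = {}" by (auto simp: E'_def)
  ultimately have cE: "card E = card E' + (card ?I + card ?O)"
    using finE by (metis (no_types, lifting) card_Un_disjoint finite_Un)
  have crossO: "card (e \<inter> insert v X) = 1" if "e \<in> ?O" for e
  proof -
    have "card e = 2" "v \<in> e" using that insert.prems by auto
    then obtain w where "e = {v, w}" "w \<noteq> v" by (auto simp: card_2_iff)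
    then have "e \<inter> insert v X = {v}"
      using that vX by (auto split: if_splits)
    then show ?thesis by simp
  qed
  have cross': "e \<inter> insert v X = e \<inter> X" if "e \<in> E'" for e using that by (auto simp: E'_def)
  show ?case
  proof (cases "card ?O \<le> card ?I")
    case True
    have "card {e \<in> E'. card (e \<inter> X) = 1} + card ?I
        = card ({e \<in> E'. card (e \<inter> X) = 1} \<union> ?I)"
      using finE by (subst card_Un_disjoint) (auto simp: E'_def)
    also have "\<dots> \<le> card {e \<in> E. card (e \<inter> X) = 1}"
      using finE by (intro card_mono) (auto simp: E'_def)
    finally show ?thesis using cE True X by (intro exI[of _ X]) auto
  next
    case False
    have "card {e \<in> E'. card (e \<inter> X) = 1} + card ?O
        = card ({e \<in> E'. card (e \<inter> X) = 1} \<union> ?O)"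
      using finE by (subst card_Un_disjoint) (auto simp: E'_def)
    also have "\<dots> \<le> card {e \<in> E. card (e \<inter> insert v X) = 1}"
    proof (intro card_mono)
      show "{e \<in> E'. card (e \<inter> X) = 1} \<union> ?O \<subseteq> {e \<in> E. card (e \<inter> insert v X) = 1}"
        using crossO cross' E'_def by auto
    qed (use finE in simp)
    finally show ?thesis using cE False X by (intro exI[of _ "insert v X"]) auto
  qed
qed

lemma ex_number_le_twice_st_number:
  assumes p: "2 \<le> p" and q: "2 \<le> q"
  shows "ex_number n (complete_bipartite p q)
           \<le> 2 * st_number n (complete_bipartite_minus_edge p q)"
proof -
  let ?K = "complete_bipartite p q" and ?G = "complete_bipartite_minus_edge p q"
  have "{Inl 0, Inr 0} \<in> edges ?K" using p q by (intro complete_bipartite_edgeI) auto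
  then obtain H :: "nat graph" where H: "simple_graph H" "num_verts H = n" "\<not> contains_copy H ?K"
    "num_edges H = ex_number n ?K"
    using ex_number_attained[of ?K n] by blast
  obtain X where X: "card (edges H) \<le> 2 * card {e \<in> edges H. card (e \<inter> X) = 1}"
    using exists_large_cut[of "verts H" "edges H"] H(1) by (auto simp: simple_graph_def)
  define H' where "H' = Graph (verts H) {e \<in> edges H. card (e \<inter> X) = 1}"
  have H': "simple_graph H'" using H(1) by (auto simp: H'_def simple_graph_def)
  have cross: "u \<in> X \<longleftrightarrow> v \<notin> X" if "{u, v} \<in> edges H'" "u \<noteq> v" for u v
    using that by (cases "u \<in> X"; cases "v \<in> X") (auto simp: H'_def Int_insert_left)
  have "\<not> (\<exists>F. subgraph F H' \<and> num_verts F = num_verts ?G \<and> contains_proper_copy F ?G)"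
  proof
    assume "\<exists>F. subgraph F H' \<and> num_verts F = num_verts ?G \<and> contains_proper_copy F ?G"
    then obtain f e where f: "embedding f ?G H'"
      and e: "e \<in> edges H'" "e \<subseteq> f ` verts ?G" "e \<notin> (`) f ` edges ?G"
      by (rule contains_proper_copyE)
    have inj: "inj_on f ({..<p} <+> {..<q})" using f by (simp add: embedding_def)
    have edge: "{f (Inl i), f (Inr j)} \<in> edges H'" if "i < p" "j < q" "(i, j) \<noteq> (0, 0)" for i j
    proof -
      have "{Inl i, Inr j} \<in> edges ?G"
        using that by (rule complete_bipartite_minus_edge_edgeI)
      then have "f ` {Inl i, Inr j} \<in> edges H'" using embedding_edge[OF f] by blast
      then show ?thesis by simp
    qed
    have cr: "f (Inl i) \<in> X \<longleftrightarrow> f (Inr j) \<notin> X" if "i < p" "j < q" "(i, j) \<noteq> (0, 0)" for i j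
      using cross[OF edge[OF that]] that inj by (auto simp: inj_on_def)
    \<comment> \<open>The vertex \<open>Inl 1\<close> is joined to the whole second side and \<open>Inr 1\<close> to the whole first
      side; this uses \<open>p, q \<ge> 2\<close>.\<close>
    have R: "f (Inr j) \<in> X \<longleftrightarrow> f (Inl 1) \<notin> X" if "j < q" for j
      using cr[of 1 j] that p by auto
    have L: "f (Inl i) \<in> X \<longleftrightarrow> f (Inl 1) \<in> X" if "i < p" for i
      using cr[of i 1] R[of 1] that q by auto
    have "card e = 2" using e H' by (simp add: simple_graph_def)
    then obtain u v where uv: "e = {u, v}" "u \<noteq> v" by (auto simp: card_2_iff)
    have "u \<in> X \<longleftrightarrow> v \<notin> X" using cross e uv by blast
    then obtain i j where ij: "i < p" "j < q" "e = {f (Inl i), f (Inr j)}"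
      using e(2) L R uv by (auto simp: insert_commute)
    have "(i, j) = (0, 0)"
    proof (rule ccontr)
      assume "(i, j) \<noteq> (0, 0)"
      then have "{Inl i, Inr j} \<in> edges ?G"
        using ij by (intro complete_bipartite_minus_edge_edgeI)
      then have "f ` {Inl i, Inr j} \<in> (`) f ` edges ?G" by (rule imageI)
      then show False using e(3) ij by simp
    qed
    then have "{f (Inl i), f (Inr j)} \<in> edges H'" if "i < p" "j < q" for i j
      using edge[OF that] e(1) ij by (cases "(i, j) = (0, 0)") auto
    then have "embedding f ?K H"
      using f unfolding embedding_def by (auto simp: edges_complete_bipartite H'_def)
    then show False
      using H(3) contains_copy_iff_embedding simple_complete_bipartite by blast
  qed
  then have "num_edges H' \<le> st_number (num_verts H') ?G" by (rule st_number_ge[OF H'])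
  then show ?thesis using X H by (simp add: H'_def)
qed

section \<open>Counting common neighbourhoods\<close>

text \<open>The common neighbours of the vertices in \<open>S\<close>; all vertices if \<open>S\<close> is empty. The
  neighbourhood of a vertex \<open>v\<close> is \<open>common_nbrs H {v}\<close>.\<close>

definition common_nbrs :: "'a graph \<Rightarrow> 'a set \<Rightarrow> 'a set" where
  "common_nbrs H S = {v \<in> verts H. \<forall>s\<in>S. {s, v} \<in> edges H}"

lemma finite_common_nbrs: "simple_graph H \<Longrightarrow> finite (common_nbrs H S)"
  by (simp add: common_nbrs_def simple_graph_def)

lemma common_nbrs_disjoint:
  assumes "simple_graph H"
  shows "S \<inter> common_nbrs H S = {}"
  using assms by (force simp: common_nbrs_def simple_graph_def)

lemma subset_common_nbrs_commute:
  assumes "S \<subseteq> verts H" "T \<subseteq> common_nbrs H S"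
  shows "S \<subseteq> common_nbrs H T"
proof
  fix s assume s: "s \<in> S"
  have "{t, s} \<in> edges H" if "t \<in> T" for t
  proof -
    have "{s, t} \<in> edges H" using assms(2) s that unfolding common_nbrs_def by blast
    then show ?thesis by (simp only: insert_commute)
  qed
  then show "s \<in> common_nbrs H T" using assms(1) s by (auto simp: common_nbrs_def)
qed

lemma sum_degree:
  assumes H: "simple_graph H"
  shows "(\<Sum>v\<in>verts H. card (common_nbrs H {v})) = 2 * num_edges H"
proof -
  have "card (common_nbrs H {v}) = card {e \<in> edges H. v \<in> e}" if "v \<in> verts H" for v
  proof (rule bij_betw_same_card)
    have "inj_on (\<lambda>w. {v, w}) (common_nbrs H {v})"
      by (auto simp: inj_on_def doubleton_eq_iff)
    moreover have "e \<in> (\<lambda>w. {v, w}) ` common_nbrs H {v}" if "e \<in> edges H" "v \<in> e" for e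
    proof -
      have "card e = 2" "e \<subseteq> verts H" using H that by (auto simp: simple_graph_def)
      then obtain w where "e = {v, w}" using \<open>v \<in> e\<close> by (auto simp: card_2_iff)
      then show ?thesis using that \<open>e \<subseteq> verts H\<close> by (auto simp: common_nbrs_def)
    qed
    then have "(\<lambda>w. {v, w}) ` common_nbrs H {v} = {e \<in> edges H. v \<in> e}"
      by (auto simp: common_nbrs_def)
    ultimately show "bij_betw (\<lambda>w. {v, w}) (common_nbrs H {v}) {e \<in> edges H. v \<in> e}"
      by (simp add: bij_betw_def)
  qed
  then have "(\<Sum>v\<in>verts H. card (common_nbrs H {v})) = (\<Sum>v\<in>verts H. card {e \<in> edges H. v \<in> e})"
    by (intro sum.cong) simp_all
  also have "\<dots> = (\<Sum>e\<in>edges H. 2)"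
  proof (rule sum_multicount_gen)
    show "\<forall>e\<in>edges H. card {v \<in> verts H. v \<in> e} = 2"
    proof
      fix e assume "e \<in> edges H"
      then have "{v \<in> verts H. v \<in> e} = e" "card e = 2" using H by (auto simp: simple_graph_def)
      then show "card {v \<in> verts H. v \<in> e} = 2" by simp
    qed
  qed (use H simple_graph_finite_edges in \<open>auto simp: simple_graph_def\<close>)
  finally show ?thesis by simp
qed

text \<open>The structural step of the count. A common neighbour \<open>a\<close> of \<open>T\<close> outside \<open>S\<close> and a common
  neighbour \<open>b\<close> of \<open>S\<close> outside \<open>T \<union> {a}\<close>, which exists as \<open>S\<close> has \<open>p + 2\<close> of them, would extend
  the complete bipartite graph on \<open>S\<close> and \<open>T\<close> to the forbidden graph with \<open>{a, b}\<close> as the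
  possibly missing edge.\<close>

lemma common_nbrs_eq_if_no_copy:
  assumes H: "simple_graph H"
    and free: "\<not> contains_copy H (complete_bipartite_minus_edge (p + 1) (p + 1))"
    and S: "S \<subseteq> verts H" "card S = p" "p + 2 \<le> card (common_nbrs H S)"
    and T: "T \<subseteq> common_nbrs H S" "card T = p"
  shows "common_nbrs H T = S"
proof (rule ccontr)
  assume "common_nbrs H T \<noteq> S"
  have ST: "S \<subseteq> common_nbrs H T" using subset_common_nbrs_commute S T by blast
  then obtain a where a: "a \<in> common_nbrs H T" "a \<notin> S" using \<open>common_nbrs H T \<noteq> S\<close> by blast
  have TV: "T \<subseteq> verts H" using T by (auto simp: common_nbrs_def)
  have fin: "finite S" "finite T"
    using S TV H finite_subset unfolding simple_graph_def by blast+
  have "card (insert a T) < card (common_nbrs H S)"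
    using card_insert_le_m1 fin T S by (simp add: card_insert_if)
  then have "\<not> common_nbrs H S \<subseteq> insert a T"
    using card_mono[of "insert a T" "common_nbrs H S"] fin by auto
  then obtain b where b: "b \<in> common_nbrs H S" "b \<noteq> a" "b \<notin> T" by blast
  have disj: "S \<inter> common_nbrs H S = {}" "T \<inter> common_nbrs H T = {}"
    using common_nbrs_disjoint[OF H] by blast+
  have "insert a S \<inter> insert b T = {}"
    using a b T disj by blast
  moreover have "{u, v} \<in> edges H" if "u \<in> insert a S" "v \<in> insert b T" "(u, v) \<noteq> (a, b)" for u v
    using that a b T by (auto simp: common_nbrs_def insert_commute)
  moreover have "insert a S \<union> insert b T \<subseteq> verts H"
    using a b S TV by (auto simp: common_nbrs_def)
  ultimately have
    "contains_copy H (complete_bipartite_minus_edge (card (insert a S)) (card (insert b T)))"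
    using fin by (intro contains_copy_complete_bipartite_minus_edgeI[where x = a and y = b]) auto
  then show False using free fin a b S T by simp
qed

lemma le_choose_plus:
  fixes p d :: nat
  assumes "1 \<le> p"
  shows "d \<le> (d choose p) + p"
proof (induction d)
  case (Suc d)
  show ?case
  proof (cases "p \<le> d")
    case True
    obtain k where k: "p = Suc k" using assms by (cases p) auto
    have "0 < (d choose k)" using True k by (intro zero_less_binomial) simp
    moreover have "(Suc d choose p) = (d choose k) + (d choose p)" by (simp add: k)
    ultimately show ?thesis using Suc by linarith
  qed simp
qed simp

text \<open>The summand \<open>1\<close> covers the case \<open>d < p\<close>, where the binomial coefficient vanishes.\<close>

lemma power_le_choose: "real d ^ p \<le> real p ^ p * (real (d choose p) + 1)"
proof (cases "p \<le> d")
  case True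
  have "(real d / real p) ^ p \<le> real (d choose p)"
    by (rule binomial_ge_n_over_k_pow_k[OF True])
  then have "real p ^ p * (real d / real p) ^ p \<le> real p ^ p * (real (d choose p) + 1)"
    by (intro mult_left_mono) auto
  moreover have "real p ^ p * (real d / real p) ^ p = real d ^ p"
    by (cases "p = 0") (simp_all add: power_mult_distrib[symmetric])
  ultimately show ?thesis by simp
next
  case False
  have "real d ^ p \<le> real p ^ p * 1" using False by (simp add: power_mono)
  also have "\<dots> \<le> real p ^ p * (real (d choose p) + 1)" by (intro mult_left_mono) auto
  finally show ?thesis .
qed

text \<open>Both sides of the double count: the sum counts the pairs of a vertex and a \<open>p\<close>-set \<open>S\<close> of
  its neighbours. Sets \<open>S\<close> that are not rich have at most \<open>p + 1\<close> common neighbours each; for a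
  rich \<open>S\<close> all but \<open>p\<close> of them are charged to the \<open>p\<close>-sets \<open>T\<close> of common neighbours of \<open>S\<close>, and
  each \<open>T\<close> is charged at most once in total.\<close>

lemma sum_choose_degree_le:
  assumes H: "simple_graph H" and p: "1 \<le> p"
    and free: "\<not> contains_copy H (complete_bipartite_minus_edge (p + 1) (p + 1))"
  shows "(\<Sum>v\<in>verts H. card (common_nbrs H {v}) choose p) \<le> (2 * p + 2) * num_verts H ^ p"
proof -
  let ?N = "common_nbrs H"
  define P where "P = {S. S \<subseteq> verts H \<and> card S = p}"
  define R where "R = {S \<in> P. p + 2 \<le> card (?N S)}"
  have finV: "finite (verts H)" using H by (simp add: simple_graph_def)
  then have finP: "finite P" by (simp add: P_def)
  have finR: "finite R" using finP by (simp add: R_def)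
  have cardP: "card P \<le> num_verts H ^ p"
  proof (cases "p \<le> num_verts H")
    case True
    then show ?thesis unfolding P_def by (simp add: n_subsets[OF finV] binomial_le_pow)
  next
    case False
    then show ?thesis unfolding P_def by (simp add: n_subsets[OF finV] binomial_eq_0)
  qed
  have choose: "card {T \<in> P. T \<subseteq> ?N S} = (card (?N S) choose p)" for S
  proof -
    have "{T \<in> P. T \<subseteq> ?N S} = {T. T \<subseteq> ?N S \<and> card T = p}"
      by (auto simp: P_def common_nbrs_def)
    then show ?thesis by (simp add: n_subsets finite_common_nbrs[OF H])
  qed
  have "(\<Sum>v\<in>verts H. card (?N {v}) choose p) = (\<Sum>v\<in>verts H. card {S \<in> P. S \<subseteq> ?N {v}})"
    by (simp add: choose)
  also have "\<dots> = (\<Sum>S\<in>P. card (?N S))"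
  proof (rule sum_multicount_gen)
    have "{v \<in> verts H. S \<subseteq> ?N {v}} = ?N S" if "S \<in> P" for S
      using that by (auto simp: P_def common_nbrs_def insert_commute)
    then show "\<forall>S\<in>P. card {v \<in> verts H. S \<subseteq> ?N {v}} = card (?N S)" by simp
  qed (fact finV finP)+
  also have "\<dots> \<le> (\<Sum>S\<in>P. (2 * p + 1) + (if S \<in> R then card (?N S) choose p else 0))"
  proof (rule sum_mono)
    fix S assume "S \<in> P"
    show "card (?N S) \<le> (2 * p + 1) + (if S \<in> R then card (?N S) choose p else 0)"
      using \<open>S \<in> P\<close> p le_choose_plus[OF p, of "card (?N S)"] by (auto simp: R_def)
  qed
  also have "\<dots> = (2 * p + 1) * card P + (\<Sum>S\<in>R. card (?N S) choose p)"
  proof -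
    have "(\<Sum>S\<in>P. if S \<in> R then card (?N S) choose p else 0) = (\<Sum>S\<in>P \<inter> R. card (?N S) choose p)"
      using finP by (simp add: sum.inter_restrict)
    moreover have "P \<inter> R = R" by (auto simp: R_def)
    ultimately show ?thesis unfolding sum.distrib by simp
  qed
  also have "(\<Sum>S\<in>R. card (?N S) choose p) = (\<Sum>S\<in>R. card {T \<in> P. T \<subseteq> ?N S})"
    by (simp add: choose)
  also have "\<dots> = (\<Sum>T\<in>P. card {S \<in> R. T \<subseteq> ?N S})"
    by (rule sum_multicount_gen) (use finP finR in auto)
  also have "\<dots> \<le> (\<Sum>T\<in>P. 1)"
  proof (rule sum_mono)
    fix T assume "T \<in> P"
    have "{S \<in> R. T \<subseteq> ?N S} \<subseteq> {?N T}"
      using \<open>T \<in> P\<close> common_nbrs_eq_if_no_copy[OF H free] by (auto simp: R_def P_def)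
    then show "card {S \<in> R. T \<subseteq> ?N S} \<le> 1"
      using card_mono[of "{?N T}"] by fastforce
  qed
  finally have "(\<Sum>v\<in>verts H. card (?N {v}) choose p) \<le> (2 * p + 2) * card P" by simp
  also have "\<dots> \<le> (2 * p + 2) * num_verts H ^ p" using cardP by (rule mult_le_mono2)
  finally show ?thesis .
qed

text \<open>A weak form of the power mean inequality, losing a factor \<open>2\<^sup>p\<close>: for \<open>t\<close> equal to half of
  the mean of \<open>d\<close>, the bound \<open>d(v)\<^sup>p \<ge> t\<^sup>p\<^sup>-\<^sup>1 (d(v) - t)\<close> can be summed over all \<open>v\<close>.\<close>

lemma sum_power_ge_mean:
  fixes d :: "'a \<Rightarrow> real"
  assumes V: "finite V" "V \<noteq> {}" and d: "\<And>v. v \<in> V \<Longrightarrow> 0 \<le> d v"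
    and sum: "sum d V = 2 * m" and m: "0 \<le> m" and p: "1 \<le> p"
  shows "card V * (m / card V) ^ p \<le> (\<Sum>v\<in>V. d v ^ p)"
proof -
  obtain k where k: "p = Suc k" using p by (cases p) auto
  define t where "t = m / card V"
  have t: "0 \<le> t" and mt: "m = card V * t" using m V by (auto simp: t_def)
  have "card V * t ^ p = t ^ k * (2 * m - card V * t)" by (simp add: k mt)
  also have "\<dots> = (\<Sum>v\<in>V. t ^ k * (d v - t))"
    using V by (simp add: sum_distrib_left[symmetric] sum_subtractf sum)
  also have "\<dots> \<le> (\<Sum>v\<in>V. d v ^ p)"
  proof (rule sum_mono)
    fix v assume v: "v \<in> V"
    show "t ^ k * (d v - t) \<le> d v ^ p"
    proof (cases "t \<le> d v")
      case True
      have "t ^ k * (d v - t) \<le> d v ^ k * d v"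
        using True t d[OF v] by (intro mult_mono power_mono) auto
      then show ?thesis by (simp add: k mult.commute)
    next
      case False
      then have "t ^ k * (d v - t) \<le> 0" using t by (simp add: mult_nonneg_nonpos)
      also have "0 \<le> d v ^ p" using d[OF v] by simp
      finally show ?thesis .
    qed
  qed
  finally show ?thesis by (simp add: t_def)
qed

lemma num_edges_power_le_if_no_copy:
  assumes H: "simple_graph H" and p: "1 \<le> p" and n: "1 \<le> num_verts H"
    and free: "\<not> contains_copy H (complete_bipartite_minus_edge (p + 1) (p + 1))"
  shows "real (num_edges H) ^ p \<le> real p ^ p * (2 * p + 3) * real (num_verts H) ^ (2 * p - 1)"
proof -
  let ?d = "\<lambda>v. card (common_nbrs H {v})"
  define n where "n = real (num_verts H)"
  have n1: "1 \<le> n" using n by (simp add: n_def)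
  have V: "finite (verts H)" "verts H \<noteq> {}" using H n by (auto simp: simple_graph_def)
  have "(\<Sum>v\<in>verts H. real (?d v)) = 2 * real (num_edges H)"
    using arg_cong[OF sum_degree[OF H], of real] by simp
  then have "n * (num_edges H / n) ^ p \<le> (\<Sum>v\<in>verts H. real (?d v) ^ p)"
    unfolding n_def by (intro sum_power_ge_mean) (use V p in auto)
  also have "\<dots> \<le> (\<Sum>v\<in>verts H. real p ^ p * (real (?d v choose p) + 1))"
    by (intro sum_mono power_le_choose)
  also have "\<dots> = real p ^ p * (real (\<Sum>v\<in>verts H. ?d v choose p) + n)"
    by (simp add: sum_distrib_left[symmetric] sum.distrib n_def)
  also have "\<dots> \<le> real p ^ p * ((2 * p + 2) * n ^ p + n ^ p)"
  proof (intro mult_left_mono add_mono)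
    have "real (\<Sum>v\<in>verts H. ?d v choose p) \<le> real ((2 * p + 2) * num_verts H ^ p)"
      using sum_choose_degree_le[OF H p free] by (rule of_nat_mono)
    then show "real (\<Sum>v\<in>verts H. ?d v choose p) \<le> (2 * p + 2) * n ^ p"
      by (simp only: of_nat_mult of_nat_power n_def)
    show "n \<le> n ^ p" using n1 p by (simp add: self_le_power)
  qed simp
  \<comment> \<open>Multiplying by \<open>n ^ (p - 1)\<close> clears the denominators on the left-hand side.\<close>
  finally have "n ^ (p - 1) * (n * (num_edges H / n) ^ p)
      \<le> n ^ (p - 1) * (real p ^ p * ((2 * p + 2) * n ^ p + n ^ p))"
    using n1 by (intro mult_left_mono) auto
  moreover have "n ^ (p - 1) * (n * (num_edges H / n) ^ p) = real (num_edges H) ^ p"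
  proof -
    have "n ^ (p - 1) * n = n ^ p" using p by (simp add: power_eq_if)
    then have "n ^ (p - 1) * (n * (num_edges H / n) ^ p) = (n * (num_edges H / n)) ^ p"
      by (simp only: mult.assoc[symmetric] power_mult_distrib)
    then show ?thesis using n1 by simp
  qed
  moreover have "n ^ (p - 1) * (real p ^ p * ((2 * p + 2) * n ^ p + n ^ p))
      = real p ^ p * (2 * p + 3) * n ^ (2 * p - 1)"
  proof -
    have "n ^ (p - 1) * (real p ^ p * ((2 * p + 2) * n ^ p + n ^ p))
        = real p ^ p * (2 * p + 3) * (n ^ (p - 1) * n ^ p)"
      by (simp add: algebra_simps)
    also have "n ^ (p - 1) * n ^ p = n ^ (2 * p - 1)"
      using p by (simp add: power_add[symmetric] mult_2)
    finally show ?thesis .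
  qed
  ultimately show ?thesis by (simp only: n_def)
qed

lemma ex_number_minus_edge_bigo:
  assumes p: "1 \<le> p"
  shows "(\<lambda>n. real (ex_number n (complete_bipartite_minus_edge (p + 1) (p + 1))))
          \<in> O(\<lambda>n. real n powr (2 - 1 / real p))"
proof -
  let ?K = "complete_bipartite_minus_edge (p + 1) (p + 1)"
  define C where "C = real p ^ p * (2 * p + 3)"
  have C: "0 \<le> C" by (simp add: C_def)
  have bound: "real (ex_number n ?K) \<le> C powr (1 / p) * real n powr (2 - 1 / p)" if n: "1 \<le> n" for n
  proof -
    have "{Inl 1, Inr 0} \<in> edges ?K" using p by (intro complete_bipartite_minus_edge_edgeI) auto
    then obtain H :: "nat graph" where H: "simple_graph H" "num_verts H = n" "\<not> contains_copy H ?K"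
      "num_edges H = ex_number n ?K"
      using ex_number_attained[of ?K n] by blast
    define m where "m = real (num_edges H)"
    have "m = (m ^ p) powr (1 / p)"
    proof (cases "m = 0")
      case False
      then have "0 < m" by (simp add: m_def)
      then show ?thesis using p by (simp add: powr_powr flip: powr_realpow)
    qed (use p in simp)
    also have "\<dots> \<le> (C * real n ^ (2 * p - 1)) powr (1 / p)"
      using num_edges_power_le_if_no_copy[OF H(1) p _ H(3)] H(2) n
      by (intro powr_mono2) (auto simp: m_def C_def)
    also have "\<dots> = C powr (1 / p) * (real n ^ (2 * p - 1)) powr (1 / p)"
      using C by (simp add: powr_mult)
    also have "(real n ^ (2 * p - 1)) powr (1 / p) = real n powr (real (2 * p - 1) / p)"
      using n by (simp add: powr_realpow[symmetric] powr_powr)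
    also have "real (2 * p - 1) / p = 2 - 1 / p"
      using p by (simp add: of_nat_diff field_simps)
    finally show ?thesis by (simp add: m_def H)
  qed
  show ?thesis
    by (rule bigoI[of _ "C powr (1 / p)"], rule eventually_mono[OF eventually_ge_at_top[of 1]])
      (use bound in auto)
qed

section \<open>The two-sided bounds\<close>

theorem proposition22:
  shows
    "(\<forall>p::nat. p \<ge> 1 \<longrightarrow>
        (\<forall>G :: 'a graph.
           simple_graph G \<and> bipartite_with_sides G (p + 1) (p + 1) \<and>
           contains_copy G (complete_bipartite p p) \<and>
           p ^ 2 \<le> num_edges G \<and> num_edges G \<le> (p + 1) ^ 2 - 2 \<longrightarrow>
           (\<forall>n \<ge> num_verts G.
              ex_number n (complete_bipartite p p) \<le> st_number n G \<and>
              st_number n G \<le> ex_number n (complete_bipartite_minus_edge (p + 1) (p + 1)))) \<and>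
        (\<lambda>n. real (ex_number n (complete_bipartite_minus_edge (p + 1) (p + 1))))
          \<in> O(\<lambda>n. real n powr (2 - 1 / real p))) \<and>
     (\<forall>p q :: nat. p \<ge> q \<and> q \<ge> 2 \<longrightarrow>
        (\<forall>n \<ge> num_verts (complete_bipartite_minus_edge p q).
           1 / 2 * real (ex_number n (complete_bipartite p q))
             \<le> real (st_number n (complete_bipartite_minus_edge p q))) \<and>
        (\<lambda>n. real (st_number n (complete_bipartite_minus_edge p q)))
          \<in> O(\<lambda>n. real n powr (2 - 1 / real p)))"
proof (intro conjI allI impI)
  fix p :: nat assume p: "p \<ge> 1"
  show "(\<lambda>n. real (ex_number n (complete_bipartite_minus_edge (p + 1) (p + 1))))
          \<in> O(\<lambda>n. real n powr (2 - 1 / real p))"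
    using ex_number_minus_edge_bigo[OF p] .
  fix G :: "'a graph" and n
  assume G: "simple_graph G \<and> bipartite_with_sides G (p + 1) (p + 1) \<and>
           contains_copy G (complete_bipartite p p) \<and>
           p ^ 2 \<le> num_edges G \<and> num_edges G \<le> (p + 1) ^ 2 - 2"
  have "{Inl 0, Inr 0} \<in> edges (complete_bipartite p p)"
    using p by (intro complete_bipartite_edgeI) auto
  then show "ex_number n (complete_bipartite p p) \<le> st_number n G"
    using G by (intro ex_number_le_st_number) auto
  have "(2::nat) \<le> (p + 1) * (p + 1)" using p mult_le_mono[of 2 "p + 1" 1 "p + 1"] by simp
  then show "st_number n G \<le> ex_number n (complete_bipartite_minus_edge (p + 1) (p + 1))"
    using G by (intro st_number_le_ex_number_minus_edge) (auto simp: power2_eq_square)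
next
  fix p q :: nat assume pq: "p \<ge> q \<and> q \<ge> 2"
  show "1 / 2 * real (ex_number n (complete_bipartite p q))
             \<le> real (st_number n (complete_bipartite_minus_edge p q))" for n
    using ex_number_le_twice_st_number[of p q n] pq by linarith
  have "(\<lambda>n. real (st_number n (complete_bipartite_minus_edge p q)))
      \<in> O(\<lambda>n. real (ex_number n (complete_bipartite_minus_edge (p + 1) (p + 1))))"
    using pq by (intro landau_o.big_mono always_eventually)
      (simp add: st_number_minus_edge_le_ex_number[unfolded Suc_eq_plus1[symmetric]])
  also have "(\<lambda>n. real (ex_number n (complete_bipartite_minus_edge (p + 1) (p + 1))))
          \<in> O(\<lambda>n. real n powr (2 - 1 / real p))"
    using pq by (intro ex_number_minus_edge_bigo) simp
  finally show "(\<lambda>n. real (st_number n (complete_bipartite_minus_edge p q)))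
          \<in> O(\<lambda>n. real n powr (2 - 1 / real p))" .
qed

end
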